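(* Let $I\subset\mathbb{R}$ be an interval, let $f:I\to\mathbb{R}$ be differentiable on the interior $I^{\circ}$ with $f'\in L[a,b]$, where $a,b\in I^{\circ}$, $a<b$, and let $\alpha,\lambda\in[0,1]$. Let $q>1$ and let $p$ satisfy $\frac1p+\frac1q=1$. If $|f'|^{q}$ is quasi-convex on $[a,b]$, then $$\left|\lambda\left(\alpha f(a)+(1-\alpha)f(b)\right)+(1-\lambda)f(\alpha a+(1-\alpha)b)-\frac{1}{b-a}\int_a^b f(x)\,dx\right|$$ $$\le (b-a)\left(\frac{1}{p+1}\right)^{1/p}\cdot\begin{cases}(1-\alpha)^{1/q}B^{1/q}\varepsilon_1^{1/p}+\alpha^{1/q}C^{1/q}\varepsilon_3^{1/p}, & \alpha\lambda\le 1-\alpha\le 1-\lambda(1-\alpha),\\ (1-\alpha)^{1/q}B^{1/q}\varepsilon_1^{1/p}+\alpha^{1/q}C^{1/q}\varepsilon_4^{1/p}, & \alpha\lambda\le 1-\lambda(1-\alpha)\le 1-\alpha,\\ (1-\alpha)^{1/q}B^{1/q}\varepsilon_2^{1/p}+\alpha^{1/q}C^{1/q}\varepsilon_3^{1/p}, & 1-\alpha\le\alpha\lambda\le 1-\lambda(1-\alpha),\end{cases}$$ where $$B=\sup\{|f'(a)|^q,|f'(\alpha a+(1-\alpha)b)|^q\},\qquad C=\sup\{|f'(b)|^q,|f'(\alpha a+(1-\alpha)b)|^q\},$$ $$\varepsilon_1=(\alpha\lambda)^{p+1}+(1-\alpha-\alpha\lambda)^{p+1},\qquad \varepsilon_2=(\alpha\lambda)^{p+1}-(\alpha\lambda-1+\alpha)^{p+1},$$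 $$\varepsilon_3=[\lambda(1-\alpha)]^{p+1}+[\alpha-\lambda(1-\alpha)]^{p+1},\qquad \varepsilon_4=[\lambda(1-\alpha)]^{p+1}-[\lambda(1-\alpha)-\alpha]^{p+1}.$$
   Context: A function $g:[a,b]\to\mathbb{R}$ is quasi-convex on $[a,b]$ if $g(tx+(1-t)y)\le\sup\{g(x),g(y)\}$ for all $x,y\in[a,b]$ and $t\in[0,1]$. $L[a,b]$ denotes the set of Lebesgue integrable functions on $[a,b]$. Each $\varepsilon_i$ is only used in the cases where the bases of its powers are nonnegative. *)

theory Defs
  imports "HOL-Analysis.Analysis"
begin

definition quasi_convex_on :: "real set \<Rightarrow> (real \<Rightarrow> real) \<Rightarrow> bool" where
  "quasi_convex_on S g \<longleftrightarrow>
     (\<forall>x\<in>S. \<forall>y\<in>S. \<forall>t\<in>{0..1}. g (t * x + (1 - t) * y) \<le> Sup {g x, g y})"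

(* The function powr is the usual real power only for nonnegative bases (0 powr r = 0
   for every r).  Under the case condition in which each eps is used, its bases
   are nonnegative. *)

definition eps1 :: "real \<Rightarrow> real \<Rightarrow> real \<Rightarrow> real" where
  "eps1 p \<alpha> lam = (\<alpha> * lam) powr (p + 1) + (1 - \<alpha> - \<alpha> * lam) powr (p + 1)"

definition eps2 :: "real \<Rightarrow> real \<Rightarrow> real \<Rightarrow> real" where
  "eps2 p \<alpha> lam = (\<alpha> * lam) powr (p + 1) - (\<alpha> * lam - 1 + \<alpha>) powr (p + 1)"

definition eps3 :: "real \<Rightarrow> real \<Rightarrow> real \<Rightarrow> real" where
  "eps3 p \<alpha> lam = (lam * (1 - \<alpha>)) powr (p + 1) + (\<alpha> - lam * (1 - \<alpha>)) powr (p + 1)"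

definition eps4 :: "real \<Rightarrow> real \<Rightarrow> real \<Rightarrow> real" where
  "eps4 p \<alpha> lam = (lam * (1 - \<alpha>)) powr (p + 1) - (lam * (1 - \<alpha>) - \<alpha>) powr (p + 1)"

end

theory Submission
  imports Defs
begin

text \<open>
  Put \<open>c = \<alpha> a + (1 - \<alpha>) b\<close>. The quantity inside the absolute value is
  \<open>1 / (b - a)\<close> times the sum of the integrals of \<open>(x - k) f' x\<close> over \<open>[a, c]\<close> with
  \<open>k = a + \<alpha> \<lambda> (b - a)\<close> and over \<open>[c, b]\<close> with \<open>k = b - \<lambda> (1 - \<alpha>) (b - a)\<close> (integrate by
  parts). By quasi-convexity \<open>\<bar>f'\<bar>\<close> is at most \<open>B powr (1/q)\<close>, resp. \<open>C powr (1/q)\<close>, on the two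
  pieces, so Hoelder's inequality is only needed for \<open>\<bar>x - k\<bar>\<close> against the constant \<open>1\<close>. The
  case distinction of the theorem is whether \<open>k\<close> lies in the respective piece; a signed power
  treats both cases at once.
\<close>

text \<open>Young's inequality is applied pointwise to \<open>g x / A\<close> and \<open>1\<close>,
  where \<open>A\<close> is the p-mean of \<open>g\<close>. Integrating it yields at most
  \<open>A * (v - u)\<close>, which is the right-hand side.\<close>

lemma integral_le_Holder_one:
  fixes g :: "real \<Rightarrow> real"
  assumes cont: "continuous_on {u..v} g" and nonneg: "\<And>x. x \<in> {u..v} \<Longrightarrow> 0 \<le> g x"
    and "u < v" and "p > 1" and "q > 1" and pq: "1 / p + 1 / q = 1"
  shows "integral {u..v} g
           \<le> (v - u) powr (1 / q) * integral {u..v} (\<lambda>x. g x powr p) powr (1 / p)"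
proof -
  define J where "J = integral {u..v} (\<lambda>x. g x powr p)"
  have contp: "continuous_on {u..v} (\<lambda>x. g x powr p)"
    using \<open>p > 1\<close> nonneg by (intro continuous_on_powr' cont continuous_on_const) auto
  have "0 \<le> J"
    unfolding J_def by (intro integral_nonneg integrable_continuous_real contp) auto
  show ?thesis
  \<comment> \<open>The normalisation below divides by the p-mean, so \<open>J = 0\<close> is
    treated apart: by continuity \<open>g\<close> then vanishes on the whole interval.\<close>
  proof (cases "J = 0")
    case True
    then have "\<forall>x\<in>{u..v}. g x powr p = 0"
      using integral_eq_0_iff[OF contp \<open>u < v\<close>] by (simp add: J_def)
    then have "integral {u..v} g = integral {u..v} (\<lambda>x. 0)"
      by (intro integral_cong) simp
    then show ?thesis by simp
  next
    case False
    with \<open>0 \<le> J\<close> have "0 < J" by simp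
    \<comment> \<open>With this scaling the p-th power of \<open>g / A\<close> integrates to
      \<open>v - u\<close>, just as the constant \<open>1\<close> does, so the two Young terms carry
      the weights \<open>1 / p\<close> and \<open>1 / q\<close> of the same quantity.\<close>
    define A where "A = (J / (v - u)) powr (1 / p)"
    have "0 < A" using \<open>0 < J\<close> \<open>u < v\<close> by (simp add: A_def)
    have J: "J = A powr p * (v - u)"
      using \<open>0 < J\<close> \<open>u < v\<close> \<open>p > 1\<close> by (simp add: A_def powr_powr)
    have "integral {u..v} g \<le> integral {u..v} (\<lambda>x. A / (A powr p * p) * g x powr p + A / q)"
    proof (intro integral_le integrable_continuous_real continuous_on_add continuous_on_mult
        continuous_on_const cont contp)
      fix x assume x: "x \<in> {u..v}"
      have "g x / A * 1 \<le> (g x / A) powr p / p + 1 powr q / q"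
        using nonneg[OF x] \<open>0 < A\<close> \<open>p > 1\<close> \<open>q > 1\<close> pq by (intro Youngs_inequality) auto
      then have "g x \<le> A * ((g x / A) powr p / p + 1 / q)"
        using \<open>0 < A\<close> by (simp add: field_simps)
      then show "g x \<le> A / (A powr p * p) * g x powr p + A / q"
        using nonneg[OF x] \<open>0 < A\<close> by (simp add: powr_divide algebra_simps)
    qed
    also have "\<dots> = A / (A powr p * p) * J + A / q * (v - u)"
    proof -
      have "((\<lambda>x. A / (A powr p * p) * g x powr p + A / q) has_integral
              A / (A powr p * p) * J + (v - u) *\<^sub>R (A / q)) {u..v}"
        unfolding J_def using \<open>u < v\<close>
        by (intro has_integral_add has_integral_mult_right integrable_integral
              integrable_continuous_real contp) (use has_integral_const_real[of "A / q" u v] in simp)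
      then show ?thesis by (simp add: integral_unique mult.commute)
    qed
    also have "\<dots> = A * (v - u) * (1 / p + 1 / q)"
      unfolding J using \<open>0 < A\<close> by (simp add: distrib_left)
    also have "\<dots> = J powr (1 / p) * ((v - u) powr 1 / (v - u) powr (1 / p))"
      using \<open>0 < J\<close> \<open>u < v\<close> by (simp add: pq A_def powr_divide)
    also have "\<dots> = (v - u) powr (1 / q) * J powr (1 / p)"
      using arg_cong[OF pq, of "\<lambda>s. s - 1 / p"] by (simp add: powr_diff)
    finally show ?thesis by (simp add: J_def)
  qed
qed

text \<open>For positive \<open>r\<close> this is the odd extension of the power function, sgn(x)
  |x|^r. Up to a factor it is an antiderivative of \<open>\<bar>x\<bar> powr (r - 1)\<close> on both
  sides of 0, so the position of \<open>k\<close> needs no case distinction before the very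
  end.\<close>

definition signed_powr :: "real \<Rightarrow> real \<Rightarrow> real" where
  "signed_powr x r = max 0 x powr r - max 0 (- x) powr r"

lemma signed_powr_nonneg: "0 \<le> x \<Longrightarrow> signed_powr x r = x powr r"
  by (simp add: signed_powr_def max_def)

lemma signed_powr_nonpos: "x \<le> 0 \<Longrightarrow> signed_powr x r = - ((- x) powr r)"
  by (simp add: signed_powr_def max_def)

lemma signed_powr_mult:
  assumes "0 \<le> L"
  shows "signed_powr (L * x) r = L powr r * signed_powr x r"
proof (cases "0 \<le> x")
  case True
  then show ?thesis using assms by (simp add: signed_powr_nonneg powr_mult)
next
  case False
  then have "L * x \<le> 0" using assms by (simp add: mult_nonneg_nonpos)
  then show ?thesis using assms False powr_mult[of L "- x" r] by (simp add: signed_powr_nonpos)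
qed

text \<open>Around a nonzero point the sign is constant, so the function agrees with a plain power
  on an open half-line.\<close>

lemma has_real_derivative_signed_powr:
  assumes "x \<noteq> 0"
  shows "((\<lambda>x. signed_powr x r) has_real_derivative r * \<bar>x\<bar> powr (r - 1)) (at x)"
proof (cases "0 < x")
  case True
  have "((\<lambda>x. x powr r) has_real_derivative r * \<bar>x\<bar> powr (r - 1)) (at x)"
    using True by (auto intro!: derivative_eq_intros)
  then show ?thesis
    by (rule has_field_derivative_transform_within_open[where S = "{0<..}"])
       (use True in \<open>auto simp: signed_powr_nonneg\<close>)
next
  case False
  with assms have "x < 0" by simp
  then have "((\<lambda>x. - ((- x) powr r)) has_real_derivative r * \<bar>x\<bar> powr (r - 1)) (at x)"
    by (auto intro!: derivative_eq_intros)
  then show ?thesis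
    by (rule has_field_derivative_transform_within_open[where S = "{..<0}"])
       (use \<open>x < 0\<close> in \<open>auto simp: signed_powr_nonpos\<close>)
qed

lemma has_integral_abs_powr:
  assumes "u \<le> v" and "0 < p"
  shows "((\<lambda>x. \<bar>x - k\<bar> powr p) has_integral
           (signed_powr (v - k) (p + 1) - signed_powr (u - k) (p + 1)) / (p + 1)) {u..v}"
proof -
  let ?F = "\<lambda>x. signed_powr (x - k) (p + 1) / (p + 1)"
  have "((\<lambda>x. \<bar>x - k\<bar> powr p) has_integral (?F v - ?F u)) {u..v}"
  \<comment> \<open>The derivative is computed only away from the zero \<open>k\<close> of the base;
    continuity of \<open>?F\<close> bridges this single exceptional point.\<close>
  proof (rule fundamental_theorem_of_calculus_strong[where S = "{k}"])
    fix x assume "x \<in> {u..v} - {k}"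
    then have "((\<lambda>x. signed_powr (x - k) (p + 1)) has_real_derivative
                 (p + 1) * \<bar>x - k\<bar> powr p * 1) (at x)"
      using has_real_derivative_signed_powr[of "x - k" "p + 1"]
      by (intro DERIV_chain2[where f = "\<lambda>x. signed_powr x (p + 1)" and g = "\<lambda>x. x - k"])
         (auto intro!: derivative_eq_intros)
    from DERIV_cdivide[OF this, of "p + 1"]
    show "(?F has_vector_derivative \<bar>x - k\<bar> powr p) (at x)"
      using \<open>0 < p\<close> by (simp add: has_real_derivative_iff_has_vector_derivative)
  next
    show "continuous_on {u..v} ?F"
      unfolding signed_powr_def using \<open>0 < p\<close>
      by (intro continuous_intros continuous_on_powr') auto
  qed (use assms in auto)
  then show ?thesis by (simp add: diff_divide_distrib)
qed

lemma integral_abs_diff_le: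
  assumes "u \<le> v" and "p > 1" and "q > 1" and "1 / p + 1 / q = 1"
  shows "integral {u..v} (\<lambda>x. \<bar>x - k\<bar>)
           \<le> (v - u) powr (1 / q) *
             ((signed_powr (v - k) (p + 1) - signed_powr (u - k) (p + 1)) / (p + 1)) powr (1 / p)"
\<comment> \<open>The degenerate interval occurs when \<open>\<alpha>\<close> is 0 or 1. Both sides
  are then 0, because \<open>0 powr (1 / q) = 0\<close>.\<close>
proof (cases "u = v")
  case False
  then have "integral {u..v} (\<lambda>x. \<bar>x - k\<bar>)
      \<le> (v - u) powr (1 / q) * integral {u..v} (\<lambda>x. \<bar>x - k\<bar> powr p) powr (1 / p)"
    using assms by (intro integral_le_Holder_one continuous_intros) auto
  also have "integral {u..v} (\<lambda>x. \<bar>x - k\<bar> powr p)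
      = (signed_powr (v - k) (p + 1) - signed_powr (u - k) (p + 1)) / (p + 1)"
    using assms by (intro integral_unique has_integral_abs_powr) auto
  finally show ?thesis .
qed simp

text \<open>Boundedness of \<open>f'\<close> suffices: \<open>(x - k) f' x\<close> is the derivative of \<open>(x - k) f x\<close> minus the
  continuous function \<open>f\<close>, hence Henstock-Kurzweil integrable.\<close>

lemma weighted_endpoints_bound:
  fixes f f' :: "real \<Rightarrow> real"
  assumes "u \<le> v" and deriv: "\<And>x. x \<in> {u..v} \<Longrightarrow> (f has_real_derivative f' x) (at x)"
    and bound: "\<And>x. x \<in> {u..v} \<Longrightarrow> \<bar>f' x\<bar> \<le> M"
  shows "\<bar>(v - k) * f v - (u - k) * f u - integral {u..v} f\<bar>
           \<le> M * integral {u..v} (\<lambda>x. \<bar>x - k\<bar>)"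
proof -
  have "continuous_on {u..v} f"
    using deriv by (meson DERIV_continuous continuous_at_imp_continuous_on)
  then have intf: "(f has_integral integral {u..v} f) {u..v}"
    by (intro integrable_integral integrable_continuous_real)
  have "((\<lambda>x. f x + (x - k) * f' x) has_integral ((v - k) * f v - (u - k) * f u)) {u..v}"
    using \<open>u \<le> v\<close>
  proof (rule fundamental_theorem_of_calculus)
    fix x assume "x \<in> {u..v}"
    then have "((\<lambda>x. (x - k) * f x) has_real_derivative f x + (x - k) * f' x) (at x)"
      by (auto intro!: derivative_eq_intros deriv)
    then show "((\<lambda>x. (x - k) * f x) has_vector_derivative f x + (x - k) * f' x)
                 (at x within {u..v})"
      by (simp add: has_real_derivative_iff_has_vector_derivative has_vector_derivative_at_within)
  qed
  from has_integral_diff[OF this intf]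
  have int: "((\<lambda>x. (x - k) * f' x) has_integral
               ((v - k) * f v - (u - k) * f u - integral {u..v} f)) {u..v}" by simp
  have "norm (integral {u..v} (\<lambda>x. (x - k) * f' x)) \<le> integral {u..v} (\<lambda>x. M * \<bar>x - k\<bar>)"
  proof (rule integral_norm_bound_integral)
    show "(\<lambda>x. (x - k) * f' x) integrable_on {u..v}" using int by blast
    show "(\<lambda>x. M * \<bar>x - k\<bar>) integrable_on {u..v}"
      by (intro integrable_continuous_real continuous_intros)
    fix x assume "x \<in> {u..v}"
    then show "norm ((x - k) * f' x) \<le> M * \<bar>x - k\<bar>"
      using mult_right_mono[OF bound, of x "\<bar>x - k\<bar>"] by (simp add: abs_mult mult.commute)
  qed
  then show ?thesis by (simp add: integral_unique[OF int])
qed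

lemma quasi_convex_on_le_max:
  assumes "quasi_convex_on S g" and "u \<in> S" and "v \<in> S" and "x \<in> {u..v}"
  shows "g x \<le> max (g u) (g v)"
proof (cases "u = v")
  case False
  \<comment> \<open>The barycentric weight of \<open>u\<close> in \<open>x\<close>.\<close>
  define t where "t = (v - x) / (v - u)"
  have t: "t \<in> {0..1}" using assms(4) False by (auto simp: t_def divide_simps)
  have "t * u + (1 - t) * v = v - t * (v - u)" by (simp add: algebra_simps)
  also have "\<dots> = x" using False by (simp add: t_def)
  finally have "x = t * u + (1 - t) * v" by simp
  moreover have "Sup {g u, g v} = max (g u) (g v)" by (simp add: cSup_eq_Max)
  ultimately show ?thesis
    using assms(1-3) t unfolding quasi_convex_on_def by metis
qed (use assms(4) in simp)

lemma quasi_convex_powr_imp_abs_le: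
  fixes h :: "real \<Rightarrow> real"
  assumes "quasi_convex_on S (\<lambda>x. \<bar>h x\<bar> powr q)" and "u \<in> S" and "v \<in> S" and "x \<in> {u..v}"
    and "0 < q"
  shows "\<bar>h x\<bar> \<le> max (\<bar>h u\<bar> powr q) (\<bar>h v\<bar> powr q) powr (1 / q)"
proof -
  have "\<bar>h x\<bar> = (\<bar>h x\<bar> powr q) powr (1 / q)" using \<open>0 < q\<close> by (simp add: powr_powr)
  also have "\<dots> \<le> max (\<bar>h u\<bar> powr q) (\<bar>h v\<bar> powr q) powr (1 / q)"
    using quasi_convex_on_le_max[OF assms(1-4)] \<open>0 < q\<close> by (intro powr_mono2) auto
  finally show ?thesis .
qed

text \<open>One half of the final estimate, in coordinates relative to \<open>L = b - a\<close>:
  \<open>h\<close> is the relative length of the piece and \<open>m\<close> the relative position of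
  \<open>k\<close> in it. Homogeneity of the signed power leaves an \<open>e\<close> that depends
  only on \<open>p\<close>, \<open>h\<close> and \<open>m\<close>, and that will become one of the
  four epsilons.\<close>

lemma weighted_endpoints_bound_scaled:
  fixes f f' :: "real \<Rightarrow> real"
  assumes "0 < L" and "0 \<le> h" and v: "v = u + L * h" and k: "k = u + L * m"
    and deriv: "\<And>x. x \<in> {u..v} \<Longrightarrow> (f has_real_derivative f' x) (at x)"
    and bound: "\<And>x. x \<in> {u..v} \<Longrightarrow> \<bar>f' x\<bar> \<le> M"
    and "p > 1" and "q > 1" and pq: "1 / p + 1 / q = 1"
    and "signed_powr (h - m) (p + 1) - signed_powr (- m) (p + 1) = e"
  shows "\<bar>(v - k) * f v - (u - k) * f u - integral {u..v} f\<bar>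
           \<le> L * (L * (1 / (p + 1)) powr (1 / p) * (h powr (1 / q) * M * e powr (1 / p)))"
proof -
  have "u \<le> v" using assms(1,2) by (simp add: v)
  then have "0 \<le> M" using bound[of u] by auto
  have "v - k = L * (h - m)" "u - k = L * (- m)" by (simp_all add: v k algebra_simps)
  then have E: "signed_powr (v - k) (p + 1) - signed_powr (u - k) (p + 1) = L powr (p + 1) * e"
    using assms by (simp only: signed_powr_mult less_imp_le flip: right_diff_distrib)
  \<comment> \<open>Up to positive factors \<open>e\<close> is the integral of
    \<open>\<bar>x - k\<bar> powr p\<close>. Its sign is needed to split the power of the product
    below.\<close>
  have "0 \<le> L powr (p + 1) * e"
    using has_integral_nonneg[OF has_integral_abs_powr[OF \<open>u \<le> v\<close>, of p k]] \<open>p > 1\<close>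
    by (simp add: E zero_le_divide_iff del: zero_le_mult_iff)
  then have "0 \<le> e" using \<open>0 < L\<close> by (simp add: zero_le_mult_iff)
  \<comment> \<open>The total exponent of \<open>L\<close>: \<open>(p + 1) / p\<close> from the p-th
    power integral and \<open>1 / q\<close> from Hoelder. One of the two factors \<open>L\<close>
    goes into \<open>K\<close>, the other cancels \<open>1 / (b - a)\<close>.\<close>
  have "(p + 1) / p + 1 / q = 2" using pq \<open>p > 1\<close> by (simp add: add_divide_distrib)
  then have LL: "L powr ((p + 1) / p) * L powr (1 / q) = L * L"
    using \<open>0 < L\<close> by (simp add: power2_eq_square flip: powr_add)
  have "\<bar>(v - k) * f v - (u - k) * f u - integral {u..v} f\<bar>
      \<le> M * integral {u..v} (\<lambda>x. \<bar>x - k\<bar>)"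
    using \<open>u \<le> v\<close> deriv bound by (rule weighted_endpoints_bound)
  also have "\<dots> \<le> M * ((v - u) powr (1 / q) * (L powr (p + 1) * e / (p + 1)) powr (1 / p))"
    using integral_abs_diff_le[OF \<open>u \<le> v\<close> \<open>p > 1\<close> \<open>q > 1\<close> pq, of k] \<open>0 \<le> M\<close>
    unfolding E by (rule mult_left_mono)
  also have "\<dots> = M * ((L * h) powr (1 / q) * (L powr (p + 1) * (e * (1 / (p + 1)))) powr (1 / p))"
    by (simp add: v)
  also have "\<dots> = M * (L powr (1 / q) * h powr (1 / q) *
                   (L powr ((p + 1) / p) * (e powr (1 / p) * (1 / (p + 1)) powr (1 / p))))"
    using \<open>0 < L\<close> \<open>0 \<le> h\<close> \<open>0 \<le> e\<close> \<open>p > 1\<close> by (simp only: powr_mult powr_powr) simp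
  also have "\<dots> = (L powr ((p + 1) / p) * L powr (1 / q)) *
                   ((1 / (p + 1)) powr (1 / p) * (h powr (1 / q) * M * e powr (1 / p)))"
    by (simp only: mult_ac)
  finally show ?thesis unfolding LL by (simp only: mult_ac)
qed

theorem theorem7:
  fixes I :: "real set" and f f' :: "real \<Rightarrow> real" and a b \<alpha> lam p q :: real
  assumes "is_interval I"
    and "\<And>x. x \<in> interior I \<Longrightarrow> (f has_real_derivative f' x) (at x)"
    and "a \<in> interior I" and "b \<in> interior I" and "a < b"
    and "f' absolutely_integrable_on {a..b}"
    and "\<alpha> \<in> {0..1}" and "lam \<in> {0..1}"
    and "q > 1" and "1 / p + 1 / q = 1"
    and "quasi_convex_on {a..b} (\<lambda>x. \<bar>f' x\<bar> powr q)"
  shows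
    "let c = \<alpha> * a + (1 - \<alpha>) * b;
         B = Sup {\<bar>f' a\<bar> powr q, \<bar>f' c\<bar> powr q};
         C = Sup {\<bar>f' b\<bar> powr q, \<bar>f' c\<bar> powr q};
         D = \<bar>lam * (\<alpha> * f a + (1 - \<alpha>) * f b) + (1 - lam) * f c
               - 1 / (b - a) * integral {a..b} f\<bar>;
         K = (b - a) * (1 / (p + 1)) powr (1 / p)
     in (\<alpha> * lam \<le> 1 - \<alpha> \<and> 1 - \<alpha> \<le> 1 - lam * (1 - \<alpha>) \<longrightarrow>
           D \<le> K * ((1 - \<alpha>) powr (1 / q) * B powr (1 / q) * eps1 p \<alpha> lam powr (1 / p)
                    + \<alpha> powr (1 / q) * C powr (1 / q) * eps3 p \<alpha> lam powr (1 / p)))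
      \<and> (\<alpha> * lam \<le> 1 - lam * (1 - \<alpha>) \<and> 1 - lam * (1 - \<alpha>) \<le> 1 - \<alpha> \<longrightarrow>
           D \<le> K * ((1 - \<alpha>) powr (1 / q) * B powr (1 / q) * eps1 p \<alpha> lam powr (1 / p)
                    + \<alpha> powr (1 / q) * C powr (1 / q) * eps4 p \<alpha> lam powr (1 / p)))
      \<and> (1 - \<alpha> \<le> \<alpha> * lam \<and> \<alpha> * lam \<le> 1 - lam * (1 - \<alpha>) \<longrightarrow>
           D \<le> K * ((1 - \<alpha>) powr (1 / q) * B powr (1 / q) * eps2 p \<alpha> lam powr (1 / p)
                    + \<alpha> powr (1 / q) * C powr (1 / q) * eps3 p \<alpha> lam powr (1 / p)))"
proof -
  define c where "c = \<alpha> * a + (1 - \<alpha>) * b"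
  define L where "L = b - a"
  \<comment> \<open>These centres make the boundary terms right: \<open>a - k1\<close> and
    \<open>b - k2\<close> give the weights of \<open>f a\<close> and \<open>f b\<close>, and
    \<open>k2 - k1 = L * (1 - lam)\<close> gives that of \<open>f c\<close>.\<close>
  define k1 where "k1 = a + L * (\<alpha> * lam)"
  define k2 where "k2 = c + L * (\<alpha> - lam * (1 - \<alpha>))"
  define B where "B = Sup {\<bar>f' a\<bar> powr q, \<bar>f' c\<bar> powr q}"
  define C where "C = Sup {\<bar>f' b\<bar> powr q, \<bar>f' c\<bar> powr q}"
  define D where "D = \<bar>lam * (\<alpha> * f a + (1 - \<alpha>) * f b) + (1 - lam) * f c
               - 1 / (b - a) * integral {a..b} f\<bar>"
  define K where "K = (b - a) * (1 / (p + 1)) powr (1 / p)"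
  have \<alpha>: "0 \<le> \<alpha>" "0 \<le> 1 - \<alpha>" and lam: "0 \<le> lam" "lam \<le> 1" using assms(7,8) by auto
  have "q > 1" by fact
  \<comment> \<open>Positivity of \<open>1 / p\<close> also rules out \<open>p = 0\<close>, where
    \<open>1 / p\<close> would be 0.\<close>
  have "1 / p = 1 - 1 / q" using assms(10) by simp
  then have "0 < 1 / p" "1 / p < 1" using \<open>q > 1\<close> by auto
  then have "p > 1" by (simp add: divide_less_eq split: if_splits)
  have "0 < L" using \<open>a < b\<close> by (simp add: L_def)
  have c: "c = a + L * (1 - \<alpha>)" and b: "b = c + L * \<alpha>"
    by (simp_all add: c_def L_def algebra_simps)
  have ac: "a \<le> c" and cb: "c \<le> b"
    using \<open>0 < L\<close> \<alpha> b unfolding c by simp_all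
  have deriv: "(f has_real_derivative f' x) (at x)" if "x \<in> {a..b}" for x
  proof (rule assms(2))
    have "is_interval (interior I)"
      using assms(1) by (simp add: is_interval_convex_1 convex_interior)
    then show "x \<in> interior I"
      using assms(3,4) that by (auto intro: mem_is_interval_1_I)
  qed
  have B: "\<bar>f' x\<bar> \<le> B powr (1 / q)" if "x \<in> {a..c}" for x
    using quasi_convex_powr_imp_abs_le[OF assms(11), of a c x] that ac cb \<open>q > 1\<close>
    by (simp add: B_def cSup_eq_Max)
  have C: "\<bar>f' x\<bar> \<le> C powr (1 / q)" if "x \<in> {c..b}" for x
    using quasi_convex_powr_imp_abs_le[OF assms(11), of c b x] that ac cb \<open>q > 1\<close>
    by (simp add: C_def cSup_eq_Max max.commute)
  have "continuous_on {a..b} f"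
    using deriv by (meson DERIV_continuous continuous_at_imp_continuous_on)
  then have split: "integral {a..b} f = integral {a..c} f + integral {c..b} f"
    using Henstock_Kurzweil_Integration.integral_combine[OF ac cb] integrable_continuous_real
    by metis
  have sum: "((c - k1) * f c - (a - k1) * f a) + ((b - k2) * f b - (c - k2) * f c)
      = L * (lam * (\<alpha> * f a + (1 - \<alpha>) * f b) + (1 - lam) * f c)"
    unfolding k1_def k2_def b unfolding c by algebra
  have LD: "L * D = \<bar>((c - k1) * f c - (a - k1) * f a - integral {a..c} f)
                    + ((b - k2) * f b - (c - k2) * f c - integral {c..b} f)\<bar>"
  proof -
    have "L * D = \<bar>L * (lam * (\<alpha> * f a + (1 - \<alpha>) * f b) + (1 - lam) * f c
               - 1 / L * integral {a..b} f)\<bar>"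
      using \<open>0 < L\<close> by (simp add: D_def L_def abs_mult)
    also have "L * (lam * (\<alpha> * f a + (1 - \<alpha>) * f b) + (1 - lam) * f c
               - 1 / L * integral {a..b} f)
       = L * (lam * (\<alpha> * f a + (1 - \<alpha>) * f b) + (1 - lam) * f c) - integral {a..b} f"
      using \<open>0 < L\<close> by (simp add: right_diff_distrib)
    finally show ?thesis unfolding sum[symmetric] split by (simp add: algebra_simps)
  qed
  \<comment> \<open>All three cases are instances of this estimate; they differ only in how the
    signed powers in \<open>e\<close> and \<open>e'\<close> evaluate.\<close>
  have main: "D \<le> K * ((1 - \<alpha>) powr (1 / q) * B powr (1 / q) * e powr (1 / p)
                    + \<alpha> powr (1 / q) * C powr (1 / q) * e' powr (1 / p))"
    if e: "signed_powr (1 - \<alpha> - \<alpha> * lam) (p + 1) - signed_powr (- (\<alpha> * lam)) (p + 1) = e"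
      and e': "signed_powr (\<alpha> - (\<alpha> - lam * (1 - \<alpha>))) (p + 1)
                 - signed_powr (- (\<alpha> - lam * (1 - \<alpha>))) (p + 1) = e'" for e e'
  proof -
    have "\<bar>(c - k1) * f c - (a - k1) * f a - integral {a..c} f\<bar>
        \<le> L * (K * ((1 - \<alpha>) powr (1 / q) * B powr (1 / q) * e powr (1 / p)))"
      using weighted_endpoints_bound_scaled[OF \<open>0 < L\<close> \<alpha>(2) c k1_def deriv B
          \<open>p > 1\<close> \<open>q > 1\<close> assms(10) e] cb by (simp add: K_def L_def)
    moreover have "\<bar>(b - k2) * f b - (c - k2) * f c - integral {c..b} f\<bar>
        \<le> L * (K * (\<alpha> powr (1 / q) * C powr (1 / q) * e' powr (1 / p)))"
      using weighted_endpoints_bound_scaled[OF \<open>0 < L\<close> \<alpha>(1) b k2_def deriv C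
          \<open>p > 1\<close> \<open>q > 1\<close> assms(10) e'] ac by (simp add: K_def L_def)
    ultimately have "L * D \<le> L * (K * ((1 - \<alpha>) powr (1 / q) * B powr (1 / q) * e powr (1 / p)))
        + L * (K * (\<alpha> powr (1 / q) * C powr (1 / q) * e' powr (1 / p)))"
      unfolding LD by linarith
    also have "\<dots> = L * (K * ((1 - \<alpha>) powr (1 / q) * B powr (1 / q) * e powr (1 / p)
                    + \<alpha> powr (1 / q) * C powr (1 / q) * e' powr (1 / p)))"
      by (simp only: distrib_left)
    finally show ?thesis using \<open>0 < L\<close> by (simp only: mult_le_cancel_left_pos)
  qed
  have al: "0 \<le> \<alpha> * lam" and la: "0 \<le> lam * (1 - \<alpha>)" using \<alpha> lam by simp_all
  \<comment> \<open>\<open>eps1\<close> belongs to \<open>k1\<close> in \<open>[a, c]\<close> and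
    \<open>eps2\<close> to \<open>k1\<close> at or beyond \<open>c\<close>; likewise
    \<open>eps3\<close> belongs to \<open>k2\<close> in \<open>[c, b]\<close> and
    \<open>eps4\<close> to \<open>k2\<close> at or before \<open>c\<close>.\<close>
  have e1: "signed_powr (1 - \<alpha> - \<alpha> * lam) (p + 1) - signed_powr (- (\<alpha> * lam)) (p + 1)
      = eps1 p \<alpha> lam" if "\<alpha> * lam \<le> 1 - \<alpha>"
    using that al by (simp add: signed_powr_nonneg signed_powr_nonpos eps1_def)
  have e2: "signed_powr (1 - \<alpha> - \<alpha> * lam) (p + 1) - signed_powr (- (\<alpha> * lam)) (p + 1)
      = eps2 p \<alpha> lam" if "1 - \<alpha> \<le> \<alpha> * lam"
    using that al by (simp add: signed_powr_nonpos eps2_def algebra_simps)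
  have e3: "signed_powr (\<alpha> - (\<alpha> - lam * (1 - \<alpha>))) (p + 1)
                 - signed_powr (- (\<alpha> - lam * (1 - \<alpha>))) (p + 1) = eps3 p \<alpha> lam"
    if "lam * (1 - \<alpha>) \<le> \<alpha>"
    unfolding eps3_def using that la
    by (subst (2) signed_powr_nonpos) (simp_all add: signed_powr_nonneg)
  have e4: "signed_powr (\<alpha> - (\<alpha> - lam * (1 - \<alpha>))) (p + 1)
                 - signed_powr (- (\<alpha> - lam * (1 - \<alpha>))) (p + 1) = eps4 p \<alpha> lam"
    if "\<alpha> \<le> lam * (1 - \<alpha>)"
    unfolding eps4_def using that la by (simp add: signed_powr_nonneg)
  \<comment> \<open>In the third case the condition selecting \<open>eps3\<close> comes from the
    chain \<open>lam * (1 - \<alpha>) \<le> 1 - \<alpha> \<le> \<alpha> * lam \<le>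
    \<alpha>\<close>.\<close>
  have "lam * (1 - \<alpha>) \<le> \<alpha>" if "1 - \<alpha> \<le> \<alpha> * lam"
    using that mult_left_le[of lam \<alpha>] mult_left_le_one_le[of "1 - \<alpha>" lam] \<alpha> lam by linarith
  then show ?thesis
    unfolding Let_def c_def[symmetric]
    unfolding B_def[symmetric] C_def[symmetric] D_def[symmetric] K_def[symmetric]
    by (intro conjI impI; elim conjE; intro main e1 e2 e3 e4) linarith+
qed

end
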